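(* Let $k,d,n$ be integers with $3\le k\le d+1$ and $n\ge 3$. \begin{enumerate} \item Suppose $\mathrm{diam}(C_n)<d$. (a) If $\mathrm{diam}(C_n)\le k-2$, then $C_n$ is $k,d$-perfect. (b) If $\mathrm{diam}(C_n)>k-2$, then $C_n$ is $k,d$-perfect if and only if \[n\le (2k-3)\left\lceil\frac{\lfloor n/2\rfloor+1}{k-1}\right\rceil .\] \item Suppose $d\le \mathrm{diam}(C_n)$ and define $q=\frac{d+1}{k-1}$. (a) If $q\in\mathbb Z$, then $C_n$ is $k,d$-perfect if and only if $q\mid n$. (b) If $q\notin\mathbb Z$, then $C_n$ is $k,d$-perfect if and only if there is no integer $j$ with \[1\le j<\frac{q-1}{\lceil q\rceil-q}\quad\text{and}\quad j\lceil q\rceil<n<(j+1)q .\] \end{enumerate}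
   Context: $C_n$ is the cycle graph on $n$ vertices; $\mathrm{diam}(C_n)=\lfloor n/2\rfloor$. All graphs are simple and undirected with nonempty vertex set. A shortest path in a graph $G$ is a path between some vertices $u,v$ whose length (number of edges) equals the graph distance between $u$ and $v$. A set $S\subseteq V(G)$ is $k,d$-independent in $G$ if every shortest path in $G$ of length at most $d$ contains fewer than $k$ vertices of $S$. The $k,d$-chromatic number $\chi^k_d(G)$ is the least positive integer $c$ such that some coloring $V(G)\to\{1,\dots,c\}$ has all color classes $k,d$-independent. A set $S\subseteq V(G)$ is a $k,d$-clique in $G$ if every $k$-element subset of $S$ is contained in some shortest path of $G$ of length at most $d$ (sets with fewer than $k$ elements are vacuously $k,d$-cliques); $\omega^k_d(G)$ is the supremum of the sizes of $k,d$-cliques in $G$. For $2\le k\le d+1$, $G$ is $k,d$-perfect if $\chi^k_d(H)=\left\lceil\frac{\omega^k_d(H)}{k-1}\right\rceil$ for every induced subgraph $H$ of $G$ (shortest paths being computed in $H$). *)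

theory Defs
  imports Complex_Main "HOL-Library.Extended_Nat"
begin

record 'a graph =
  verts :: "'a set"
  edges :: "'a set set"

definition simple_graph :: "'a graph \<Rightarrow> bool" where
  "simple_graph G \<longleftrightarrow>
     verts G \<noteq> {} \<and> (\<forall>e \<in> edges G. \<exists>u \<in> verts G. \<exists>v \<in> verts G. u \<noteq> v \<and> e = {u, v})"

definition induced_subgraph :: "'a graph \<Rightarrow> 'a graph \<Rightarrow> bool" where
  "induced_subgraph H G \<longleftrightarrow>
     verts H \<noteq> {} \<and> verts H \<subseteq> verts G \<and> edges H = {e \<in> edges G. e \<subseteq> verts H}"

(* A path is given by its nonempty list of vertices; a single vertex is a path of length 0. *)
definition is_path :: "'a graph \<Rightarrow> 'a list \<Rightarrow> bool" where
  "is_path G p \<longleftrightarrow>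
     p \<noteq> [] \<and> distinct p \<and> set p \<subseteq> verts G \<and> successively (\<lambda>x y. {x, y} \<in> edges G) p"

definition path_between :: "'a graph \<Rightarrow> 'a \<Rightarrow> 'a list \<Rightarrow> 'a \<Rightarrow> bool" where
  "path_between G u p v \<longleftrightarrow> is_path G p \<and> hd p = u \<and> last p = v"

definition path_length :: "'a list \<Rightarrow> nat" where
  "path_length p = length p - 1"

(* The distance between vertices of different components is the infimum of the empty set,
   which is infinite. *)
definition gdist :: "'a graph \<Rightarrow> 'a \<Rightarrow> 'a \<Rightarrow> enat" where
  "gdist G u v = (INF p \<in> {p. path_between G u p v}. enat (path_length p))"

definition diam :: "'a graph \<Rightarrow> enat" where
  "diam G = (SUP u \<in> verts G. SUP v \<in> verts G. gdist G u v)"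

definition shortest_path :: "'a graph \<Rightarrow> 'a list \<Rightarrow> bool" where
  "shortest_path G p \<longleftrightarrow>
     (\<exists>u v. path_between G u p v \<and> enat (path_length p) = gdist G u v)"

definition kd_independent :: "nat \<Rightarrow> nat \<Rightarrow> 'a graph \<Rightarrow> 'a set \<Rightarrow> bool" where
  "kd_independent k d G S \<longleftrightarrow>
     S \<subseteq> verts G \<and>
     (\<forall>p. shortest_path G p \<and> path_length p \<le> d \<longrightarrow> card (S \<inter> set p) < k)"

definition kd_colorable :: "nat \<Rightarrow> nat \<Rightarrow> 'a graph \<Rightarrow> nat \<Rightarrow> bool" where
  "kd_colorable k d G c \<longleftrightarrow>
     (\<exists>f. f ` verts G \<subseteq> {1..c} \<and>
          (\<forall>i \<in> {1..c}. kd_independent k d G {v \<in> verts G. f v = i}))"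

(* An infinite graph without a suitable finite coloring gets the value infinity. *)
definition kd_chromatic_number :: "nat \<Rightarrow> nat \<Rightarrow> 'a graph \<Rightarrow> enat" where
  "kd_chromatic_number k d G = (INF c \<in> {c. 1 \<le> c \<and> kd_colorable k d G c}. enat c)"

definition kd_clique :: "nat \<Rightarrow> nat \<Rightarrow> 'a graph \<Rightarrow> 'a set \<Rightarrow> bool" where
  "kd_clique k d G S \<longleftrightarrow>
     S \<subseteq> verts G \<and>
     (\<forall>T. T \<subseteq> S \<and> finite T \<and> card T = k \<longrightarrow>
        (\<exists>p. shortest_path G p \<and> path_length p \<le> d \<and> T \<subseteq> set p))"

(* Every subset of a k,d-clique is a k,d-clique, so taking the supremum over the finite ones
   loses nothing: an infinite k,d-clique makes the supremum infinite. *)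
definition kd_clique_number :: "nat \<Rightarrow> nat \<Rightarrow> 'a graph \<Rightarrow> enat" where
  "kd_clique_number k d G = (SUP S \<in> {S. finite S \<and> kd_clique k d G S}. enat (card S))"

definition ceiling_div :: "enat \<Rightarrow> nat \<Rightarrow> enat" where
  "ceiling_div w m =
     (case w of enat a \<Rightarrow> enat (nat \<lceil>real a / real m\<rceil>) | \<infinity> \<Rightarrow> \<infinity>)"

(* Meaningful for 2 \<le> k \<le> d + 1 only. *)
definition kd_perfect :: "nat \<Rightarrow> nat \<Rightarrow> 'a graph \<Rightarrow> bool" where
  "kd_perfect k d G \<longleftrightarrow>
     (\<forall>H. induced_subgraph H G \<longrightarrow>
        kd_chromatic_number k d H = ceiling_div (kd_clique_number k d H) (k - 1))"

(* A simple cycle only for n \<ge> 3. *)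
definition cycle_graph :: "nat \<Rightarrow> nat graph" where
  "cycle_graph n = \<lparr>verts = {..<n}, edges = {{i, (i + 1) mod n} | i. i < n}\<rparr>"

lemma simple_graph_induced_subgraph:
  assumes "simple_graph G" and "induced_subgraph H G"
  shows "simple_graph H"
  using assms unfolding simple_graph_def induced_subgraph_def by fastforce

lemma simple_graph_cycle_graph:
  assumes "n \<ge> 3"
  shows "simple_graph (cycle_graph n)"
proof -
  have "i \<noteq> (i + 1) mod n" if "i < n" for i
    using that assms by (cases "i + 1 = n") auto
  moreover have "(i + 1) mod n < n" for i
    using assms by simp
  ultimately show ?thesis
    using assms unfolding simple_graph_def cycle_graph_def by fastforce
qed

end

theory Submission
  imports Defs "HOL-Number_Theory.Cong"
begin

text \<open>Put \<open>w = k - 1\<close>, \<open>L = min d \<lfloor>n/2\<rfloor> + 1\<close> and \<open>c = \<lceil>L/w\<rceil>\<close>. Always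
  \<open>\<chi> \<ge> \<lceil>\<omega>/w\<rceil>\<close>. A proper induced subgraph of the cycle is a union of paths, all of whose
  subpaths are shortest; colouring its vertices cyclically by position attains the bound. In the
  cycle itself, \<open>S\<close> is independent iff every arc of \<open>L\<close> vertices meets it in at most \<open>w\<close>
  vertices, and \<open>\<lceil>\<omega>/w\<rceil> = c\<close>. Counting incidences with arcs bounds a colour class by
  \<open>\<lfloor>w n/L\<rfloor>\<close>, and cutting the cycle into that many almost equal blocks shows that \<open>c\<close> colours
  suffice as soon as \<open>n \<le> c \<lfloor>w n/L\<rfloor>\<close>. Perfection is therefore equivalent to this inequality,
  and the stated criteria are its arithmetic reformulations.\<close>

section \<open>Arcs of the cycle\<close>

text \<open>The start \<open>a\<close> may be any natural number, so that arcs can be continued past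
  \<open>n\<close> without reducing it. \<open>l\<close> counts vertices, not edges.\<close>

definition arc_list :: "nat \<Rightarrow> nat \<Rightarrow> nat \<Rightarrow> nat list" where
  "arc_list n a l = map (\<lambda>i. (a + i) mod n) [0..<l]"

definition arc :: "nat \<Rightarrow> nat \<Rightarrow> nat \<Rightarrow> nat set" where
  "arc n a l = (\<lambda>i. (a + i) mod n) ` {..<l}"

lemma length_arc_list [simp]: "length (arc_list n a l) = l"
  by (simp add: arc_list_def)

lemma nth_arc_list [simp]: "i < l \<Longrightarrow> arc_list n a l ! i = (a + i) mod n"
  by (simp add: arc_list_def)

lemma set_arc_list [simp]: "set (arc_list n a l) = arc n a l"
  by (auto simp: arc_list_def arc_def)

lemma arc_list_Suc: "arc_list n a (Suc l) = arc_list n a l @ [(a + l) mod n]"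
  by (simp add: arc_list_def)

lemma arc_list_Suc_Cons: "arc_list n a (Suc l) = (a mod n) # arc_list n (Suc a) l"
  by (rule nth_equalityI) (auto simp: nth_Cons split: nat.split)

lemma arc_list_mod: "arc_list n (a mod n) l = arc_list n a l"
  by (simp add: arc_list_def mod_add_left_eq)

lemma arc_mod: "arc n (a mod n) l = arc n a l"
  by (simp add: arc_def mod_add_left_eq)

lemma hd_arc_list: "0 < l \<Longrightarrow> hd (arc_list n a l) = a mod n"
  by (cases l) (auto simp: arc_list_Suc_Cons)

lemma last_arc_list: "0 < l \<Longrightarrow> last (arc_list n a l) = (a + l - 1) mod n"
  by (cases l) (auto simp: arc_list_Suc)

lemma arc_mono: "l \<le> l' \<Longrightarrow> arc n a l \<subseteq> arc n a l'"
  by (auto simp: arc_def)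

lemma finite_arc [simp]: "finite (arc n a l)"
  by (simp add: arc_def)

lemma arc_subset: "0 < n \<Longrightarrow> arc n a l \<subseteq> {..<n}"
  by (auto simp: arc_def)

lemma card_arc_le: "card (arc n a l) \<le> l"
  unfolding arc_def using card_image_le[of "{..<l}"] by simp

lemma inj_on_add_mod: "l \<le> n \<Longrightarrow> inj_on (\<lambda>i. (a + i) mod n) {..<l}"
  for n :: nat
proof (rule inj_onI)
  fix i j :: nat
  assume l: "l \<le> n" and i: "i \<in> {..<l}" and j: "j \<in> {..<l}"
    and "(a + i) mod n = (a + j) mod n"
  then have "[a + i = a + j] (mod n)" by (simp add: cong_def)
  then have "[i = j] (mod n)" by (simp add: cong_add_lcancel_nat)
  with l i j show "i = j" by (simp add: cong_less_modulus_unique_nat)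
qed

lemma card_arc: "l \<le> n \<Longrightarrow> card (arc n a l) = l"
  unfolding arc_def by (simp add: card_image inj_on_add_mod)

lemma distinct_arc_list: "l \<le> n \<Longrightarrow> distinct (arc_list n a l)"
  using card_arc[of l n a] by (metis card_distinct length_arc_list set_arc_list)

text \<open>The last disjunct is the part of the arc that has wrapped past \<open>n\<close>. In this
  form membership is open to linear arithmetic.\<close>

lemma arc_iff:
  assumes "a < n" "y < n" "l \<le> n"
  shows "y \<in> arc n a l \<longleftrightarrow> a \<le> y \<and> y < a + l \<or> y + n < a + l"
proof
  assume "y \<in> arc n a l"
  then obtain i where i: "i < l" "y = (a + i) mod n" by (auto simp: arc_def)
  then show "a \<le> y \<and> y < a + l \<or> y + n < a + l"
    using assms by (cases "a + i < n") (auto simp: mod_if)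
next
  assume *: "a \<le> y \<and> y < a + l \<or> y + n < a + l"
  show "y \<in> arc n a l"
  proof (cases "y + n < a + l")
    case True
    then have "y = (a + (y + n - a)) mod n" using assms by simp
    moreover have "y + n - a < l" using True assms by linarith
    ultimately show ?thesis unfolding arc_def by blast
  next
    case False
    then have "y = (a + (y - a)) mod n" "y - a < l" using * assms by auto
    then show ?thesis unfolding arc_def by blast
  qed
qed

section \<open>Paths of the cycle\<close>

lemma verts_cycle_graph [simp]: "verts (cycle_graph n) = {..<n}"
  by (simp add: cycle_graph_def)

lemma edge_cycle_graph_iff:
  assumes "x < n" "y < n"
  shows "{x, y} \<in> edges (cycle_graph n) \<longleftrightarrow> y = Suc x mod n \<or> x = Suc y mod n"
  using assms by (auto simp: cycle_graph_def doubleton_eq_iff)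

lemma successively_arc_list:
  assumes "0 < n"
  shows "successively (\<lambda>x y. {x, y} \<in> edges (cycle_graph n)) (arc_list n a l)"
  unfolding successively_conv_nth
  using assms by (auto simp: edge_cycle_graph_iff mod_Suc_eq)

lemma is_path_rev:
  "is_path G p \<Longrightarrow> is_path G (rev p)"
  by (auto simp: is_path_def successively_rev insert_commute)

lemma Suc_mod_inj:
  assumes "x < n" "y < n" "Suc x mod n = Suc y mod n"
  shows "x = (y::nat)"
  using assms by (auto simp: mod_if split: if_splits)

text \<open>A path in a cycle cannot turn back, since the vertex behind it is already used. The
  induction prepends a vertex \<open>x\<close> to a path whose direction is known.\<close>

lemma is_path_cycle_graph_cases:
  assumes "is_path (cycle_graph n) p"
  obtains a where "a < n" "p = arc_list n a (length p)"
  | a where "a < n" "rev p = arc_list n a (length p)"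
proof -
  have "\<exists>a<n. p = arc_list n a (length p) \<or> rev p = arc_list n a (length p)"
    using assms
  proof (induction p)
    case Nil
    then show ?case by (simp add: is_path_def)
  next
    case (Cons x p)
    from Cons.prems have xn: "x < n" by (simp add: is_path_def)
    then have n0: "0 < n" by simp
    show ?case
    proof (cases p)
      case Nil
      then show ?thesis using xn by (auto simp: arc_list_def intro!: exI[of _ x])
    next
      case (Cons y zs)
      have yn: "y < n" and path: "is_path (cycle_graph n) p" and xp: "x \<notin> set p"
        and edge: "y = Suc x mod n \<or> x = Suc y mod n"
        using Cons.prems Cons edge_cycle_graph_iff[of x n y] by (auto simp: is_path_def)
      obtain a where an: "a < n"
        and a: "p = arc_list n a (length p) \<or> rev p = arc_list n a (length p)"
        using Cons.IH[OF path] by blast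
      define l where "l = length zs"
      have lp: "length p = Suc l" using Cons by (simp add: l_def)
      from a show ?thesis
      proof
        assume asc: "p = arc_list n a (length p)"
        then have ay: "a = y" using an Cons lp by (simp add: arc_list_Suc_Cons)
        show ?thesis
        proof (cases "y = Suc x mod n")
          case True
          have "x # p = x # arc_list n (Suc x mod n) (length p)"
            using asc ay True by simp
          then have "x # p = arc_list n x (length (x # p))"
            using xn by (simp add: arc_list_mod arc_list_Suc_Cons)
          then show ?thesis using xn by blast
        next
          case False
          then have x: "x = Suc y mod n" using edge by blast
          \<comment> \<open>Here \<open>x\<close> lies on the side towards which \<open>p\<close>
            ascends; a second vertex of \<open>p\<close> would be \<open>x\<close> itself.\<close>
          have "l = 0"
          proof (rule ccontr)
            assume "l \<noteq> 0"
            then have "p ! 1 = Suc y mod n" "1 < length p"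
              using asc ay lp by (metis One_nat_def Suc_less_eq add.commute neq0_conv nth_arc_list
                  plus_1_eq_Suc, simp add: lp)
            then show False using xp x by (metis nth_mem)
          qed
          then have "p = [y]" using Cons l_def by simp
          then have "rev (x # p) = arc_list n y (length (x # p))"
            using x yn by (simp add: arc_list_def)
          then show ?thesis using yn by blast
        qed
      next
        assume desc: "rev p = arc_list n a (length p)"
        have y: "y = (a + l) mod n"
          using desc Cons lp by (simp add: arc_list_Suc)
        show ?thesis
        proof (cases "x = Suc y mod n")
          case True
          then have "x = (a + length p) mod n"
            using y lp by (simp add: mod_Suc_eq)
          then have "rev (x # p) = arc_list n a (length (x # p))"
            using desc by (simp add: arc_list_Suc)
          then show ?thesis using an by blast
        next
          case False
          then have x: "y = Suc x mod n" using edge by blast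
          \<comment> \<open>The mirror case: \<open>Suc\<close> modulo \<open>n\<close> is
            injective, so a vertex preceding \<open>y\<close> on the ascending list
            \<open>rev p\<close> would equal \<open>x\<close>.\<close>
          have "l = 0"
          proof (rule ccontr)
            assume "l \<noteq> 0"
            then obtain l' where l': "l = Suc l'" by (cases l) auto
            have "rev p ! l' = (a + l') mod n" "l' < length p"
              using desc lp l' by simp_all
            then have "(a + l') mod n \<in> set p"
              by (metis length_rev nth_mem set_rev)
            moreover have "Suc ((a + l') mod n) mod n = y"
              using y l' by (simp add: mod_Suc_eq)
            then have "x = (a + l') mod n"
              using x xn n0 Suc_mod_inj[of x n "(a + l') mod n"] by simp
            ultimately show False using xp by simp
          qed
          then have "p = [y]" using Cons l_def by simp
          then have "x # p = arc_list n x (length (x # p))"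
            using x xn by (simp add: arc_list_def)
          then show ?thesis using xn by blast
        qed
      qed
    qed
  qed
  then show ?thesis using that by blast
qed

lemma is_path_induced_arc_list:
  assumes "induced_subgraph H (cycle_graph n)" "0 < l" "l \<le> n" "arc n a l \<subseteq> verts H"
  shows "is_path H (arc_list n a l)"
proof -
  have "successively (\<lambda>x y. {x, y} \<in> edges (cycle_graph n)) (arc_list n a l)"
    using assms by (intro successively_arc_list) auto
  then have "successively (\<lambda>x y. {x, y} \<in> edges H) (arc_list n a l)"
    by (rule successively_mono) (use assms in \<open>auto simp: induced_subgraph_def\<close>)
  then show ?thesis
    using assms distinct_arc_list[of l n a]
    by (auto simp: is_path_def simp flip: length_0_conv)
qed

lemma induced_subgraph_refl: "verts G \<noteq> {} \<Longrightarrow> simple_graph G \<Longrightarrow> induced_subgraph G G"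
  by (auto simp: induced_subgraph_def simple_graph_def)

lemma is_path_induced:
  assumes "induced_subgraph H G" "is_path H p"
  shows "is_path G p"
  using assms successively_mono[of "\<lambda>x y. {x, y} \<in> edges H" p "\<lambda>x y. {x, y} \<in> edges G"]
  by (auto simp: is_path_def induced_subgraph_def)

lemma length_path_cycle_graph:
  assumes "is_path (cycle_graph n) p"
  shows "length p \<le> n"
  using assms card_mono[of "{..<n}" "set p"] by (auto simp: is_path_def distinct_card)

text \<open>The second arc starts in the last vertex of the first and runs on until it is back at
  the start. Both end vertices are counted twice, whence \<open>n + 2\<close> entries in
  total.\<close>

lemma arc_Un_arc:
  assumes "0 < n" "0 < l" "l \<le> n"
  shows "arc n a l \<union> arc n (a + l - 1) (n + 2 - l) = {..<n}"
proof
  show "arc n a l \<union> arc n (a + l - 1) (n + 2 - l) \<subseteq> {..<n}"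
    using assms arc_subset by blast
  show "{..<n} \<subseteq> arc n a l \<union> arc n (a + l - 1) (n + 2 - l)"
  proof
    fix x assume "x \<in> {..<n}"
    moreover have "arc n a n = {..<n}"
      using assms arc_subset card_arc[of n n a] by (intro card_subset_eq) auto
    ultimately obtain i where i: "i < n" "x = (a + i) mod n"
      unfolding arc_def by blast
    show "x \<in> arc n a l \<union> arc n (a + l - 1) (n + 2 - l)"
    proof (cases "i < l")
      case True
      then show ?thesis using i by (auto simp: arc_def)
    next
      case False
      then have "x = (a + l - 1 + (i - (l - 1))) mod n" "i - (l - 1) < n + 2 - l"
        using i assms by auto
      then show ?thesis unfolding arc_def by blast
    qed
  qed
qed

text \<open>With the same direction, equal ends force equal lengths. With opposite directions the
  paths are single vertices or the two ways around the cycle.\<close>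

lemma paths_same_ends:
  assumes p: "is_path (cycle_graph n) p" and p': "is_path (cycle_graph n) p'"
    and hd: "hd p = hd p'" and last: "last p = last p'"
  shows "length p = length p' \<or> length p + length p' = n + 2 \<and> set p \<union> set p' = {..<n}"
proof -
  have same: "l = l'" if "arc_list n a l = r" "arc_list n a' l' = r'" "a < n" "a' < n"
      "0 < l" "0 < l'" "l \<le> n" "l' \<le> n" "hd r = hd r'" "last r = last r'"
    for a l a' l' r r'
  proof -
    have [simp]: "a' = a" using that hd_arc_list[of l n a] hd_arc_list[of l' n a'] by simp
    have "(a + (l - 1)) mod n = (a + (l' - 1)) mod n"
      using that last_arc_list[of l n a] last_arc_list[of l' n a] by auto
    then have "l - 1 = l' - 1"
      using inj_onD[OF inj_on_add_mod[of n n a], of "l - 1" "l' - 1"] that by simp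
    with that show ?thesis by simp
  qed
  have opp: "l = l' \<or> l + l' = n + 2 \<and> arc n a l \<union> arc n b l' = {..<n}"
    if "arc_list n a l = r" "arc_list n b l' = rev r'" "a < n" "b < n"
      "0 < l" "0 < l'" "l \<le> n" "l' \<le> n" "hd r = hd r'" "last r = last r'" "r' \<noteq> []"
    for a l b l' r r'
  proof -
    have b: "b = (a + l - 1) mod n"
      using that last_arc_list[of l n a] hd_arc_list[of l' n b] by (simp add: hd_rev)
    have a: "a = (b + l' - 1) mod n"
      using that hd_arc_list[of l n a] last_arc_list[of l' n b] by (simp add: last_rev)
    \<comment> \<open>Going along \<open>r\<close> and then along \<open>rev r'\<close> takes
      \<open>l + l' - 2\<close> steps and returns to \<open>a\<close>, so this number is a multiple
      of \<open>n\<close>.\<close>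
    have "a = (b + (l' - 1)) mod n" using a that by simp
    also have "\<dots> = ((a + l - 1) + (l' - 1)) mod n"
      by (subst b) (rule mod_add_left_eq)
    also have "a + l - 1 + (l' - 1) = a + (l + l' - 2)" using that by simp
    finally have "(a + (l + l' - 2)) mod n = a mod n" using that by simp
    then have dv: "n dvd l + l' - 2"
      by (metis add_diff_cancel_left' mod_eq_dvd_iff_nat le_add1)
    \<comment> \<open>Both lists have at most \<open>n\<close> entries, so the multiple is below
      \<open>2 * n\<close>; zero belongs to two single vertices.\<close>
    have "l + l' - 2 = 0 \<or> l + l' - 2 = n"
    proof -
      obtain m where m: "l + l' - 2 = n * m" using dv by blast
      have "n * m < n * 2" using m that by linarith
      then have "m < 2" by simp
      then show ?thesis using m by (auto simp: less_2_cases_iff)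
    qed
    then show ?thesis
    proof
      assume "l + l' - 2 = n"
      then have "l + l' = n + 2" using that by linarith
      then have l': "l' = n + 2 - l" by linarith
      have "arc n a l \<union> arc n b l' = {..<n}"
        unfolding l' b arc_mod using that by (intro arc_Un_arc) auto
      with \<open>l + l' = n + 2\<close> show ?thesis by simp
    qed (use that in linarith)
  qed
  have ne: "p \<noteq> []" "p' \<noteq> []" using p p' by (auto simp: is_path_def)
  have len: "length p \<le> n" "length p' \<le> n" "0 < length p" "0 < length p'"
    using p p' ne length_path_cycle_graph by auto
  show ?thesis
  proof (cases rule: is_path_cycle_graph_cases[OF p])
    case a: (1 a)
    show ?thesis
    proof (cases rule: is_path_cycle_graph_cases[OF p'])
      case (1 b)
      with a same[of a "length p" p b "length p'" p'] len hd last show ?thesis by simp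
    next
      case (2 b)
      with a opp[of a "length p" p b "length p'" p'] len hd last ne show ?thesis
        by (metis set_arc_list set_rev)
    qed
  next
    case a: (2 a)
    show ?thesis
    proof (cases rule: is_path_cycle_graph_cases[OF p'])
      case (1 b)
      with a opp[of b "length p'" p' a "length p" p] len hd last ne show ?thesis
        by (metis set_arc_list set_rev Un_commute add.commute)
    next
      case (2 b)
      have "hd (rev p) = hd (rev p')" "last (rev p) = last (rev p')"
        using hd last by (simp_all only: hd_rev last_rev)
      with 2 a same[of a "length p" "rev p" b "length p'" "rev p'"] len show ?thesis
        by metis
    qed
  qed
qed

section \<open>Shortest paths and the diameter\<close>

lemma path_set_arc:
  assumes "is_path (cycle_graph n) p"
  obtains a where "a < n" "set p = arc n a (length p)"
  using assms by (metis is_path_cycle_graph_cases set_arc_list set_rev)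

text \<open>Replaces the infimum in \<open>enat\<close> by a comparison of list lengths. Paths are
  nonempty, so comparing \<open>length\<close> and comparing \<open>path_length\<close>
  agree.\<close>

lemma shortest_path_iff:
  "shortest_path G p \<longleftrightarrow> is_path G p \<and>
     (\<forall>p'. is_path G p' \<and> hd p' = hd p \<and> last p' = last p \<longrightarrow> length p \<le> length p')"
proof
  assume "shortest_path G p"
  then have p: "is_path G p"
    and eq: "enat (path_length p) = gdist G (hd p) (last p)"
    by (auto simp: shortest_path_def path_between_def)
  have "length p \<le> length p'" if p': "is_path G p'" "hd p' = hd p" "last p' = last p" for p'
  proof -
    have "gdist G (hd p) (last p) \<le> enat (path_length p')"
      unfolding gdist_def by (rule INF_lower) (use that in \<open>simp add: path_between_def\<close>)
    then have "length p - 1 \<le> length p' - 1"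
      by (simp flip: eq add: path_length_def)
    moreover have "0 < length p'" using p' by (auto simp: is_path_def)
    ultimately show ?thesis by linarith
  qed
  with p show "is_path G p \<and>
     (\<forall>p'. is_path G p' \<and> hd p' = hd p \<and> last p' = last p \<longrightarrow> length p \<le> length p')"
    by blast
next
  assume *: "is_path G p \<and>
     (\<forall>p'. is_path G p' \<and> hd p' = hd p \<and> last p' = last p \<longrightarrow> length p \<le> length p')"
  then have "gdist G (hd p) (last p) = enat (path_length p)"
    unfolding gdist_def
    by (intro antisym INF_lower INF_greatest)
       (auto simp: path_between_def path_length_def)
  then show "shortest_path G p"
    using * by (auto simp: shortest_path_def path_between_def)
qed

text \<open>Two paths with the same ends and different lengths together cover the whole cycle, which
  is impossible when a vertex is missing. So in \<open>H\<close> the ends of a path determine its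
  length.\<close>

lemma shortest_path_proper_induced:
  assumes H: "induced_subgraph H (cycle_graph n)" and ne: "verts H \<noteq> {..<n}"
  shows "shortest_path H p \<longleftrightarrow> is_path H p"
proof -
  have "length p = length p'"
    if "is_path H p" "is_path H p'" "hd p = hd p'" "last p = last p'" for p p'
  proof -
    have "set p \<union> set p' \<noteq> {..<n}"
      using that H ne by (auto simp: is_path_def induced_subgraph_def)
    then show ?thesis
      using paths_same_ends[OF is_path_induced[OF H that(1)] is_path_induced[OF H that(2)]] that
      by blast
  qed
  then show ?thesis unfolding shortest_path_iff by (metis order_refl)
qed

lemma induced_cycle_refl: "3 \<le> n \<Longrightarrow> induced_subgraph (cycle_graph n) (cycle_graph n)"
  using simple_graph_cycle_graph[of n]
  by (intro induced_subgraph_refl) (auto simp: lessThan_empty_iff)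

lemma is_path_arc_list:
  "3 \<le> n \<Longrightarrow> 0 < l \<Longrightarrow> l \<le> n \<Longrightarrow> is_path (cycle_graph n) (arc_list n a l)"
  using arc_subset[of n a l] by (intro is_path_induced_arc_list induced_cycle_refl) auto

text \<open>The way around the other side is the competitor that prevents paths longer than
  \<open>n div 2\<close> from being shortest.\<close>

lemma other_path:
  assumes "3 \<le> n" "is_path (cycle_graph n) p" "2 \<le> length p"
  obtains p' where "is_path (cycle_graph n) p'" "hd p' = hd p" "last p' = last p"
    "length p' = n + 2 - length p"
proof -
  have *: "\<exists>r'. is_path (cycle_graph n) r' \<and> hd r' = hd r \<and> last r' = last r \<and>
      length r' = n + 2 - l"
    if r: "r = arc_list n a l" and l: "2 \<le> l" "l \<le> n" and a: "a < n" for r a l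
  proof (intro exI conjI)
    \<comment> \<open>With \<open>2 \<le> l\<close> this arc has at most \<open>n\<close> vertices,
      so it does not meet itself.\<close>
    let ?q = "arc_list n (a + l - 1) (n + 2 - l)"
    have ne: "?q \<noteq> []" using l by (simp flip: length_0_conv)
    show "is_path (cycle_graph n) (rev ?q)"
      using assms l by (intro is_path_rev is_path_arc_list) auto
    show "hd (rev ?q) = hd r"
      using l r ne a by (simp add: hd_rev hd_arc_list last_arc_list)
    show "last (rev ?q) = last r"
      using l r ne a by (simp add: last_rev hd_arc_list last_arc_list)
    show "length (rev ?q) = n + 2 - l" by simp
  qed
  have len: "length p \<le> n" using assms length_path_cycle_graph by blast
  have ne: "p \<noteq> []" using assms by auto
  show ?thesis
  proof (cases rule: is_path_cycle_graph_cases[OF assms(2)])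
    case (1 a)
    then have "\<exists>r'. is_path (cycle_graph n) r' \<and> hd r' = hd p \<and> last r' = last p \<and>
        length r' = n + 2 - length p"
      using * len assms by blast
    then show ?thesis using that by blast
  next
    case (2 a)
    with *[of "rev p" a "length p"] len assms obtain r' where
      r': "is_path (cycle_graph n) r'" "hd r' = last p" "last r' = hd p"
        "length r' = n + 2 - length p"
      using ne by (metis hd_rev last_rev)
    show ?thesis
    proof (rule that)
      show "is_path (cycle_graph n) (rev r')" using r' is_path_rev by blast
      show "hd (rev r') = hd p" "last (rev r') = last p"
        using r' by (simp_all only: hd_rev last_rev)
      show "length (rev r') = n + 2 - length p" using r' by simp
    qed
  qed
qed

text \<open>Counted in edges, two paths with the same ends have equal lengths or lengths adding up
  to \<open>n\<close>, so the shortest paths are those with at most half of the edges.\<close>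

lemma shortest_path_cycle_graph:
  assumes "3 \<le> n"
  shows "shortest_path (cycle_graph n) p \<longleftrightarrow>
    is_path (cycle_graph n) p \<and> path_length p \<le> n div 2"
proof
  assume s: "shortest_path (cycle_graph n) p"
  then have p: "is_path (cycle_graph n) p" by (simp add: shortest_path_iff)
  moreover have "path_length p \<le> n div 2"
  proof (cases "2 \<le> length p")
    case True
    obtain p' where "is_path (cycle_graph n) p'" "hd p' = hd p" "last p' = last p"
      "length p' = n + 2 - length p"
      using other_path[OF assms p True] .
    with s have "length p \<le> n + 2 - length p" by (auto simp: shortest_path_iff)
    then show ?thesis using True by (simp add: path_length_def)
  qed (simp add: path_length_def)
  ultimately show "is_path (cycle_graph n) p \<and> path_length p \<le> n div 2" by simp
next
  assume *: "is_path (cycle_graph n) p \<and> path_length p \<le> n div 2"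
  have "length p \<le> length p'"
    if "is_path (cycle_graph n) p'" "hd p' = hd p" "last p' = last p" for p'
  proof -
    have "length p = length p' \<or> length p + length p' = n + 2"
      using paths_same_ends[of n p p'] that * by auto
    moreover have "length p - 1 \<le> n div 2" using * by (simp add: path_length_def)
    ultimately show ?thesis by linarith
  qed
  with * show "shortest_path (cycle_graph n) p" by (simp add: shortest_path_iff)
qed

lemma diam_cycle_graph:
  assumes "3 \<le> n"
  shows "diam (cycle_graph n) = enat (n div 2)"
proof (rule antisym)
  have "gdist (cycle_graph n) x y \<le> enat (n div 2)" if xy: "x < n" "y < n" for x y
  proof -
    have "\<exists>p. path_between (cycle_graph n) x p y \<and> path_length p \<le> n div 2"
    proof -
      have pth: "\<exists>p. path_between (cycle_graph n) u p v \<and> path_length p \<le> n div 2"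
        if "u < n" "v = (u + j) mod n" "j \<le> n div 2" for u v j
        by (rule exI[of _ "arc_list n u (Suc j)"])
           (use that assms in \<open>auto simp: path_between_def path_length_def hd_arc_list
             last_arc_list intro!: is_path_arc_list\<close>)
      \<comment> \<open>\<open>j\<close> steps forward lead from \<open>x\<close> to
        \<open>y\<close>, and \<open>n - j\<close> steps forward from \<open>y\<close> to
        \<open>x\<close>; one of the two numbers is at most \<open>n div 2\<close>.\<close>
      define j where "j = (y + n - x) mod n"
      have j: "j < n" "y = (x + j) mod n" "x = (y + (n - j)) mod n"
        using that unfolding j_def by (auto simp: mod_if)
      show ?thesis
      proof (cases "j \<le> n div 2")
        case True
        then show ?thesis using pth[of x y j] j that by blast
      next
        case False
        then have "n - j \<le> n div 2" by linarith
        then obtain p where p: "path_between (cycle_graph n) y p x" "path_length p \<le> n div 2"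
          using pth[of y x "n - j"] j xy by blast
        then have "p \<noteq> []" by (auto simp: path_between_def is_path_def)
        with p have "path_between (cycle_graph n) x (rev p) y" "path_length (rev p) \<le> n div 2"
          by (auto simp: path_between_def path_length_def hd_rev last_rev intro: is_path_rev)
        then show ?thesis by blast
      qed
    qed
    then obtain p where "path_between (cycle_graph n) x p y" "path_length p \<le> n div 2"
      by blast
    then show ?thesis
      unfolding gdist_def by (intro INF_lower2[of p]) auto
  qed
  then show "diam (cycle_graph n) \<le> enat (n div 2)"
    unfolding diam_def by (auto intro!: SUP_least)
next
  \<comment> \<open>A path with \<open>n div 2\<close> edges is still shortest, so its ends attain
    the bound.\<close>
  let ?p = "arc_list n 0 (Suc (n div 2))"
  have "shortest_path (cycle_graph n) ?p"
    using assms by (auto simp: shortest_path_cycle_graph path_length_def intro!: is_path_arc_list)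
  then obtain u v where "path_between (cycle_graph n) u ?p v"
    "enat (path_length ?p) = gdist (cycle_graph n) u v"
    unfolding shortest_path_def by blast
  moreover from this have "u \<in> verts (cycle_graph n)" "v \<in> verts (cycle_graph n)"
    by (auto simp only: path_between_def is_path_def dest: hd_in_set last_in_set)
  ultimately have "enat (n div 2) = gdist (cycle_graph n) u v"
    and uv: "u \<in> verts (cycle_graph n)" "v \<in> verts (cycle_graph n)"
    by (simp_all add: path_length_def)
  then show "enat (n div 2) \<le> diam (cycle_graph n)"
    unfolding diam_def by (metis SUP_upper order_trans)
qed

section \<open>Chromatic number and clique number of arbitrary graphs\<close>

lemma ceiling_div_le_iff:
  assumes "0 < m"
  shows "ceiling_div x m \<le> enat c \<longleftrightarrow> x \<le> enat (c * m)"
proof (cases x)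
  case (enat a)
  have "nat \<lceil>real a / real m\<rceil> \<le> c \<longleftrightarrow> real a / real m \<le> real c"
    by (simp add: nat_le_iff ceiling_le_iff)
  also have "\<dots> \<longleftrightarrow> real a \<le> real (c * m)"
    using assms by (simp add: pos_divide_le_eq)
  also have "\<dots> \<longleftrightarrow> a \<le> c * m" by (rule of_nat_le_iff)
  finally show ?thesis using enat by (simp add: ceiling_div_def)
qed (simp add: ceiling_div_def)

lemma kd_clique_number_le_iff:
  "kd_clique_number k d G \<le> enat b \<longleftrightarrow> (\<forall>S. finite S \<and> kd_clique k d G S \<longrightarrow> card S \<le> b)"
  by (auto simp: kd_clique_number_def SUP_le_iff)

text \<open>Additional colours have empty classes, which are independent by
  \<open>0 < k\<close>.\<close>

lemma kd_colorable_mono: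
  assumes "kd_colorable k d G c" "c \<le> c'" "0 < k"
  shows "kd_colorable k d G c'"
proof -
  obtain f where f: "f ` verts G \<subseteq> {1..c}"
    and ind: "\<And>i. i \<in> {1..c} \<Longrightarrow> kd_independent k d G {v \<in> verts G. f v = i}"
    using assms by (auto simp: kd_colorable_def)
  have "kd_independent k d G {v \<in> verts G. f v = i}" for i
  proof (cases "i \<in> {1..c}")
    case False
    then have "{v \<in> verts G. f v = i} = {}" using f by auto
    then show ?thesis using assms unfolding kd_independent_def by (metis Int_empty_left card.empty empty_subsetI)
  qed (rule ind)
  moreover have "f ` verts G \<subseteq> {1..c'}"
    using f assms by fastforce
  ultimately show ?thesis unfolding kd_colorable_def by blast
qed

text \<open>A colour class with \<open>k\<close> vertices of the clique would contain a
  \<open>k\<close>-set lying on one shortest path of length at most \<open>d\<close>. So every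
  colour takes at most \<open>k - 1\<close> vertices of \<open>S\<close>.\<close>

lemma card_clique_le:
  assumes "kd_colorable k d G c" "kd_clique k d G S" "finite S"
  shows "card S \<le> c * (k - 1)"
proof -
  obtain f where f: "f ` verts G \<subseteq> {1..c}"
    and ind: "\<And>i. i \<in> {1..c} \<Longrightarrow> kd_independent k d G {v \<in> verts G. f v = i}"
    using assms by (auto simp: kd_colorable_def)
  have S: "S \<subseteq> verts G" using assms by (simp add: kd_clique_def)
  have le: "card {v \<in> S. f v = i} \<le> k - 1" if "i \<in> {1..c}" for i
  proof (rule ccontr)
    assume "\<not> ?thesis"
    then have "k \<le> card {v \<in> S. f v = i}" by simp
    then obtain T where T: "T \<subseteq> {v \<in> S. f v = i}" "card T = k" "finite T"
      by (rule obtain_subset_with_card_n)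
    then obtain p where p: "shortest_path G p" "path_length p \<le> d" "T \<subseteq> set p"
      using assms(2) unfolding kd_clique_def by blast
    then have "card ({v \<in> verts G. f v = i} \<inter> set p) < k"
      using ind[OF that] unfolding kd_independent_def by blast
    moreover have "T \<subseteq> {v \<in> verts G. f v = i} \<inter> set p" using T p S by auto
    then have "card T \<le> card ({v \<in> verts G. f v = i} \<inter> set p)"
      by (intro card_mono) auto
    ultimately show False using T by simp
  qed
  have "card S = card (\<Union>i\<in>{1..c}. {v \<in> S. f v = i})"
    using S f by (intro arg_cong[where f = card]) auto
  also have "\<dots> \<le> (\<Sum>i\<in>{1..c}. card {v \<in> S. f v = i})"
    by (rule card_UN_le) simp
  also have "\<dots> \<le> (\<Sum>i\<in>{1..c}. k - 1)" by (intro sum_mono le)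
  finally show ?thesis by simp
qed

text \<open>If no number up to \<open>c\<close> were admissible, the infimum would be at least
  \<open>Suc c\<close>. An admissible number up to \<open>c\<close> can be raised to
  \<open>c\<close>.\<close>

lemma kd_chromatic_number_le_iff:
  assumes "0 < k" "1 \<le> c"
  shows "kd_chromatic_number k d G \<le> enat c \<longleftrightarrow> kd_colorable k d G c"
proof
  assume le: "kd_chromatic_number k d G \<le> enat c"
  have "\<exists>c'. kd_colorable k d G c' \<and> c' \<le> c"
  proof (rule ccontr)
    assume "\<not> ?thesis"
    then have "enat (Suc c) \<le> kd_chromatic_number k d G"
      unfolding kd_chromatic_number_def by (intro INF_greatest) (auto simp: not_le Suc_le_eq)
    then have "enat (Suc c) \<le> enat c" using le by (rule order_trans)
    then show False by simp
  qed
  then show "kd_colorable k d G c" using assms kd_colorable_mono by blast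
next
  assume "kd_colorable k d G c"
  then show "kd_chromatic_number k d G \<le> enat c"
    unfolding kd_chromatic_number_def using assms by (intro INF_lower) auto
qed

text \<open>Half of the equation in \<open>kd_perfect\<close>, valid in every graph.\<close>

lemma ceiling_div_clique_number_le:
  assumes "2 \<le> k"
  shows "ceiling_div (kd_clique_number k d G) (k - 1) \<le> kd_chromatic_number k d G"
  unfolding kd_chromatic_number_def
proof (rule INF_greatest)
  fix c assume "c \<in> {c. 1 \<le> c \<and> kd_colorable k d G c}"
  then show "ceiling_div (kd_clique_number k d G) (k - 1) \<le> enat c"
    using assms card_clique_le by (auto simp: ceiling_div_le_iff kd_clique_number_le_iff)
qed

lemma le_ceiling_div_clique_number:
  assumes "2 \<le> k" "kd_clique k d G S" "finite S" "(c - 1) * (k - 1) < card S"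
  shows "enat c \<le> ceiling_div (kd_clique_number k d G) (k - 1)"
proof -
  have "\<not> ceiling_div (kd_clique_number k d G) (k - 1) \<le> enat (c - 1)"
    using assms by (auto simp: ceiling_div_le_iff kd_clique_number_le_iff not_le)
  then show ?thesis
    by (cases "ceiling_div (kd_clique_number k d G) (k - 1)") auto
qed

section \<open>Independent sets and cliques of the cycle in terms of arcs\<close>

lemma shortest_path_subset_arc:
  assumes "3 \<le> n" "shortest_path (cycle_graph n) p" "path_length p \<le> d"
  obtains a where "a < n" "set p \<subseteq> arc n a (Suc (min d (n div 2)))"
proof -
  have p: "is_path (cycle_graph n) p" and "path_length p \<le> n div 2"
    using assms by (auto simp: shortest_path_cycle_graph)
  then have "length p \<le> Suc (min d (n div 2))"
    using assms by (simp add: path_length_def)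
  moreover obtain a where "a < n" "set p = arc n a (length p)"
    using path_set_arc[OF p] .
  ultimately show ?thesis using that arc_mono by metis
qed

lemma shortest_path_arc_list:
  assumes "3 \<le> n" "l \<le> n div 2"
  shows "shortest_path (cycle_graph n) (arc_list n a (Suc l))"
  using assms
  by (auto simp: shortest_path_cycle_graph path_length_def intro!: is_path_arc_list)

text \<open>Each path in question lies in an arc of \<open>Suc (min d (n div 2))\<close> vertices,
  and each such arc is itself a shortest path of length at most \<open>d\<close>. So arcs can
  replace paths.\<close>

lemma kd_independent_cycle_iff:
  assumes "3 \<le> n"
  shows "kd_independent k d (cycle_graph n) S \<longleftrightarrow>
    S \<subseteq> {..<n} \<and> (\<forall>a<n. card (S \<inter> arc n a (Suc (min d (n div 2)))) < k)"
    (is "_ \<longleftrightarrow> _ \<and> (\<forall>a<n. card (S \<inter> arc n a ?L) < k)")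
proof -
  have "card (S \<inter> set p) < k"
    if all: "\<forall>a<n. card (S \<inter> arc n a ?L) < k"
      and p: "shortest_path (cycle_graph n) p" "path_length p \<le> d" for p
  proof -
    obtain a where "a < n" "set p \<subseteq> arc n a ?L"
      using shortest_path_subset_arc[OF assms p] by metis
    then have "card (S \<inter> set p) \<le> card (S \<inter> arc n a ?L)" "card (S \<inter> arc n a ?L) < k"
      using all by (auto intro!: card_mono)
    then show ?thesis by simp
  qed
  moreover have "card (S \<inter> arc n a ?L) < k"
    if "kd_independent k d (cycle_graph n) S" for a
  proof -
    have "shortest_path (cycle_graph n) (arc_list n a ?L)"
      using assms by (intro shortest_path_arc_list) auto
    moreover have "path_length (arc_list n a ?L) \<le> d" by (simp add: path_length_def)
    ultimately have "card (S \<inter> set (arc_list n a ?L)) < k"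
      using that unfolding kd_independent_def by blast
    then show ?thesis by simp
  qed
  ultimately show ?thesis by (auto simp: kd_independent_def)
qed

lemma kd_clique_cycle_iff:
  assumes "3 \<le> n"
  shows "kd_clique k d (cycle_graph n) S \<longleftrightarrow> S \<subseteq> {..<n} \<and>
    (\<forall>T. T \<subseteq> S \<and> card T = k \<longrightarrow> (\<exists>a<n. T \<subseteq> arc n a (Suc (min d (n div 2)))))"
    (is "_ \<longleftrightarrow> _ \<and> (\<forall>T. _ \<longrightarrow> (\<exists>a<n. T \<subseteq> arc n a ?L))")
proof -
  have "(\<exists>p. shortest_path (cycle_graph n) p \<and> path_length p \<le> d \<and> T \<subseteq> set p) \<longleftrightarrow>
      (\<exists>a<n. T \<subseteq> arc n a ?L)" for T
  proof
    assume "\<exists>p. shortest_path (cycle_graph n) p \<and> path_length p \<le> d \<and> T \<subseteq> set p"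
    then show "\<exists>a<n. T \<subseteq> arc n a ?L"
      using shortest_path_subset_arc[OF assms] by (metis order_trans)
  next
    assume "\<exists>a<n. T \<subseteq> arc n a ?L"
    then obtain a where "T \<subseteq> arc n a ?L" by blast
    moreover have "shortest_path (cycle_graph n) (arc_list n a ?L)"
      using assms by (intro shortest_path_arc_list) auto
    moreover have "path_length (arc_list n a ?L) \<le> d" by (simp add: path_length_def)
    ultimately show "\<exists>p. shortest_path (cycle_graph n) p \<and> path_length p \<le> d \<and> T \<subseteq> set p"
      by (intro exI[of _ "arc_list n a ?L"]) (simp only: set_arc_list simp_thms)
  qed
  moreover have "finite T" if "T \<subseteq> S" "S \<subseteq> {..<n}" for T
    using that finite_subset by (metis finite_lessThan)
  ultimately show ?thesis unfolding kd_clique_def verts_cycle_graph by metis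
qed

lemma kd_clique_arc:
  assumes "3 \<le> n"
  shows "kd_clique k d (cycle_graph n) (arc n 0 (Suc (min d (n div 2))))"
proof -
  have "0 < n" using assms by simp
  then show ?thesis
    using arc_subset unfolding kd_clique_cycle_iff[OF assms] by blast
qed

section \<open>Proper induced subgraphs\<close>

text \<open>Members of one residue class modulo \<open>c\<close> lie in different blocks
  \<open>i div c\<close>, and at most \<open>w * c\<close> positions make at most \<open>w\<close>
  blocks.\<close>

lemma card_residue_class_le:
  fixes b c l r w :: nat
  assumes "l \<le> w * c"
  shows "card {i. i < l \<and> (b + i) mod c = r} \<le> w"
proof -
  let ?I = "{i. i < l \<and> (b + i) mod c = r}"
  have "inj_on (\<lambda>i. i div c) ?I"
  proof (rule inj_onI)
    fix i j assume ij: "i \<in> ?I" "j \<in> ?I" "i div c = j div c"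
    then have "[b + i = b + j] (mod c)" by (simp add: cong_def)
    then have "[i = j] (mod c)" by (simp only: cong_add_lcancel_nat)
    then have "i mod c = j mod c" by (simp add: cong_def)
    with ij show "i = j" by (metis div_mult_mod_eq)
  qed
  moreover have "(\<lambda>i. i div c) ` ?I \<subseteq> {..<w}"
    using assms by (auto simp: less_mult_imp_div_less)
  ultimately have "card ?I \<le> card {..<w}" by (intro card_inj_on_le) auto
  then show ?thesis by simp
qed

text \<open>In natural numbers \<open>c\<close> is \<open>\<lceil>m / w\<rceil>\<close>; these
  bounds characterise it.\<close>

lemma ceil_div_bounds:
  fixes m w :: nat
  assumes "0 < w" "0 < m"
  defines "c \<equiv> (m + w - 1) div w"
  shows "1 \<le> c" "m \<le> c * w" "(c - 1) * w < m"
proof -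
  have "c * w \<le> m + w - 1" "m + w - 1 < c * w + w"
    using assms mod_less_divisor[of w "m + w - 1"] div_mult_mod_eq[of "m + w - 1" w]
    unfolding c_def by linarith+
  moreover have "1 \<le> c" using assms by (simp add: c_def Suc_le_eq div_greater_zero_iff)
  ultimately show "1 \<le> c" "m \<le> c * w" "(c - 1) * w < m"
    using assms(1,2) by (simp_all only: diff_mult_distrib)
qed

text \<open>A missing vertex cuts the cycle open. Counted from there, the vertices of a path in
  \<open>H\<close> have consecutive positions, so colouring positions modulo \<open>c\<close>
  spreads the colours evenly along the path.\<close>

lemma kd_colorable_proper_induced:
  assumes H: "induced_subgraph H (cycle_graph n)" and ne: "verts H \<noteq> {..<n}"
    and len: "\<And>p. is_path H p \<Longrightarrow> path_length p \<le> d \<Longrightarrow> length p \<le> c * (k - 1)"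
    and c: "0 < c" and k: "0 < k"
  shows "kd_colorable k d H c"
proof -
  have sub: "verts H \<subseteq> {..<n}" using H by (simp add: induced_subgraph_def)
  then obtain z where z: "z < n" "z \<notin> verts H" using ne by blast
  define pos where "pos v = (v + (n - z)) mod n" for v
  have "card ({v \<in> verts H. Suc (pos v mod c) = j} \<inter> set p) < k"
    if p: "shortest_path H p" "path_length p \<le> d" for j p
  proof -
    define l where "l = length p"
    have path: "is_path H p" using p(1) by (simp add: shortest_path_iff)
    then have l: "l \<le> (k - 1) * c" using len p(2) by (simp add: l_def mult.commute)
    obtain a where a: "a < n" "set p = arc n a l"
      unfolding l_def using path_set_arc[OF is_path_induced[OF H path]] .
    have z_arc: "z \<notin> arc n a l" using path a(2) z(2) by (auto simp: is_path_def)
    have pos: "pos ((a + i) mod n) = pos a + i" if i: "i < l" for i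
    proof -
      \<comment> \<open>Positions wrap only at \<open>z\<close>, whose position is 0; a wrap would
        put \<open>z\<close> on the path.\<close>
      have "pos a + i < n"
      proof (rule ccontr)
        assume "\<not> ?thesis"
        moreover have "pos a < n" using a by (simp add: pos_def)
        ultimately have i0: "n - pos a < l" "pos a + (n - pos a) = n" using i by auto
        have "(a + (n - pos a) + (n - z)) mod n = (pos a + (n - pos a)) mod n"
          unfolding pos_def by (metis add.commute add.left_commute mod_add_left_eq)
        also have "\<dots> = 0" using i0 by simp
        also have "\<dots> = (z + (n - z)) mod n" using z by simp
        finally have "[a + (n - pos a) + (n - z) = z + (n - z)] (mod n)" by (simp add: cong_def)
        then have "[a + (n - pos a) = z] (mod n)" by (simp only: cong_add_rcancel_nat)
        then have "z = (a + (n - pos a)) mod n" using z by (simp add: cong_def)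
        then show False using z_arc i0(1) by (auto simp: arc_def)
      qed
      moreover have "pos ((a + i) mod n) = (pos a + i) mod n"
        unfolding pos_def by (metis add.commute add.left_commute mod_add_left_eq)
      ultimately show ?thesis by simp
    qed
    let ?I = "{i. i < l \<and> (pos a + i) mod c = j - 1}"
    have "{v \<in> verts H. Suc (pos v mod c) = j} \<inter> set p \<subseteq> (\<lambda>i. (a + i) mod n) ` ?I"
      unfolding a(2) by (auto simp: arc_def pos)
    then have "card ({v \<in> verts H. Suc (pos v mod c) = j} \<inter> set p) \<le> card ?I"
      by (rule surj_card_le[rotated]) simp
    also have "\<dots> \<le> k - 1" using l by (rule card_residue_class_le)
    finally show ?thesis using k by linarith
  qed
  then show ?thesis
    using c unfolding kd_colorable_def kd_independent_def
    by (intro exI[of _ "\<lambda>v. Suc (pos v mod c)"]) (auto simp: Suc_le_eq)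
qed

text \<open>A longest path among those of length at most \<open>d\<close> serves both bounds: its
  vertices form a clique because every path in \<open>H\<close> is shortest, and its number of
  vertices governs the colouring.\<close>

lemma kd_chromatic_number_proper_induced:
  assumes H: "induced_subgraph H (cycle_graph n)" and ne: "verts H \<noteq> {..<n}" and k: "2 \<le> k"
  shows "kd_chromatic_number k d H = ceiling_div (kd_clique_number k d H) (k - 1)"
proof -
  obtain v where v: "v \<in> verts H" using H by (auto simp: induced_subgraph_def)
  have "is_path H [v] \<and> path_length [v] \<le> d"
    using v by (simp add: is_path_def path_length_def)
  moreover have "\<forall>p. is_path H p \<and> path_length p \<le> d \<longrightarrow> length p < Suc n"
    using is_path_induced[OF H] length_path_cycle_graph by (simp add: less_Suc_eq_le)
  ultimately have "\<exists>p. (is_path H p \<and> path_length p \<le> d) \<and>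
      (\<forall>p'. is_path H p' \<and> path_length p' \<le> d \<longrightarrow> length p' \<le> length p)"
    by (rule Lattices_Big.ex_has_greatest_nat)
  then obtain p where p: "is_path H p" "path_length p \<le> d"
    and max: "\<And>p'. is_path H p' \<Longrightarrow> path_length p' \<le> d \<Longrightarrow> length p' \<le> length p"
    by metis
  define c where "c = (length p + (k - 1) - 1) div (k - 1)"
  have "0 < length p" using p by (simp add: is_path_def)
  then have c: "1 \<le> c" "length p \<le> c * (k - 1)" "(c - 1) * (k - 1) < length p"
    using ceil_div_bounds[of "k - 1" "length p"] k by (auto simp: c_def)
  have "kd_colorable k d H c"
  proof (rule kd_colorable_proper_induced[OF H ne])
    show "length p' \<le> c * (k - 1)" if "is_path H p'" "path_length p' \<le> d" for p'
      using max[OF that] c(2) by (rule order_trans)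
  qed (use c k in auto)
  then have "kd_chromatic_number k d H \<le> enat c"
    using k c by (simp add: kd_chromatic_number_le_iff)
  also have "shortest_path H p" using shortest_path_proper_induced[OF H ne] p by blast
  then have "kd_clique k d H (set p)"
    using p unfolding kd_clique_def is_path_def by blast
  then have "enat c \<le> ceiling_div (kd_clique_number k d H) (k - 1)"
    using k c p by (intro le_ceiling_div_clique_number[of k d H "set p"])
      (auto simp: is_path_def distinct_card)
  finally show ?thesis using ceiling_div_clique_number_le[OF k, of d H] by (rule antisym)
qed

section \<open>Cliques of the whole cycle\<close>

text \<open>The hypothesis \<open>5 \<le> card S\<close> excludes \<open>n = 4\<close>, \<open>m = 2\<close>, \<open>S = {..<4}\<close>, where every triple
  contains an antipodal pair.\<close>

lemma card_le_if_triples_in_half_arcs: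
  assumes S: "S \<subseteq> {..<n}" and m: "2 * m \<le> n" and five: "5 \<le> card S"
    and tri: "\<And>a b c. a \<in> S \<Longrightarrow> b \<in> S \<Longrightarrow> c \<in> S \<Longrightarrow> a < b \<Longrightarrow> b < c \<Longrightarrow>
      c \<le> a + m \<or> n + a \<le> b + m \<or> n + b \<le> c + m"
  shows "card S \<le> Suc m"
proof -
  have fin: "finite S" using S finite_subset by blast
  have ne: "S \<noteq> {}" using five by auto
  define a c where "a = Min S" and "c = Max S"
  have a: "a \<in> S" "\<And>x. x \<in> S \<Longrightarrow> a \<le> x" and c: "c \<in> S" "\<And>x. x \<in> S \<Longrightarrow> x \<le> c"
    using fin ne by (auto simp: a_def c_def)
  have cn: "c < n" using c S by auto
  show ?thesis
  proof (cases "c \<le> a + m")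
    case True
    have "S \<subseteq> {a..a + m}" using a c True by fastforce
    then show ?thesis using card_mono[of "{a..a + m}" S] by simp
  next
    case False
    \<comment> \<open>\<open>P\<close> collects the vertices reached from \<open>c\<close> within
      \<open>m\<close> steps through 0, \<open>Q\<close> those from which \<open>a\<close> is
      reached in this way. The triple of \<open>a\<close>, \<open>x\<close> and \<open>c\<close>
      puts every other \<open>x\<close> into one of them.\<close>
    define P Q where "P = {x \<in> S. n + x \<le> c + m}" and "Q = {x \<in> S. n + a \<le> x + m}"
    have PQ: "x \<in> P \<or> x \<in> Q" if x: "x \<in> S" "x \<noteq> a" "x \<noteq> c" for x
    proof -
      have "a < x" "x < c" using a(2)[OF x(1)] c(2)[OF x(1)] x by auto
      then show ?thesis using tri[OF a(1) x(1) c(1)] x False by (auto simp: P_def Q_def)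
    qed
    have "\<exists>x\<in>S. x \<noteq> a \<and> x \<noteq> c"
    proof (rule ccontr)
      assume "\<not> ?thesis"
      then have "card S \<le> card {a, c}" by (intro card_mono) auto
      then show False using five card_insert_le_m1[of 2 "{c}" a] by simp
    qed
    then obtain x where x: "x \<in> S" "x \<in> P \<or> x \<in> Q" using PQ by blast
    then have "n + a \<le> c + m" using a(2)[OF x(1)] c(2)[OF x(1)] by (auto simp: P_def Q_def)
    then have aP: "a \<in> P" and cQ: "c \<in> Q" using a c by (auto simp: P_def Q_def)
    have finPQ: "finite P" "finite Q" using fin by (auto simp: P_def Q_def)
    \<comment> \<open>No element of \<open>S\<close> lies strictly between \<open>p\<close> and
      \<open>q\<close>.\<close>
    define p q where "p = Max P" and "q = Min Q"
    have p: "p \<in> P" "\<And>x. x \<in> P \<Longrightarrow> x \<le> p" and q: "q \<in> Q" "\<And>x. x \<in> Q \<Longrightarrow> q \<le> x"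
      using finPQ aP cQ by (auto simp: p_def q_def intro: Max_in Min_in)
    have pS: "p \<in> S" "n + p \<le> c + m" and qS: "q \<in> S" "n + a \<le> q + m"
      using p q by (auto simp: P_def Q_def)
    have ap: "a \<le> p" "q \<le> c" using a(2)[OF pS(1)] c(2)[OF qS(1)] by auto
    have cover: "x \<le> p \<or> q \<le> x" if "x \<in> S" for x
      using PQ[OF that] p(2) q(2) aP cQ by blast
    show ?thesis
    proof (cases "n + p \<le> q + m")
      case True
      \<comment> \<open>The arc from \<open>q\<close> through 0 to \<open>p\<close> has at most
        \<open>m + 1\<close> vertices and contains \<open>S\<close>.\<close>
      have "x \<in> {a..p} \<union> {q..c}" if "x \<in> S" for x
        using cover[OF that] a(2)[OF that] c(2)[OF that] by auto
      then have "S \<subseteq> {a..p} \<union> {q..c}" by blast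
      then have "card S \<le> card ({a..p} \<union> {q..c})" by (intro card_mono) auto
      also have "\<dots> \<le> card {a..p} + card {q..c}" by (rule card_Un_le)
      also have "\<dots> = (Suc p - a) + (Suc c - q)" by simp
      also have "\<dots> \<le> Suc m" using True ap cn by linarith
      finally show ?thesis .
    next
      case neg: False
      have "a < p" using neg qS ap by (cases "a = p") auto
      have "q < c" using neg pS ap by (cases "q = c") auto
      have "p < q"
        using pS qS cn m neg \<open>a < p\<close> by linarith
      \<comment> \<open>The triples now force equality: \<open>n = 2 * m\<close>, and
        \<open>a\<close>, \<open>q\<close> as well as \<open>p\<close>, \<open>c\<close> are
        antipodal. A fifth vertex would form a forbidden triple with two of these, contrary to
        \<open>five\<close>.\<close>
      have "c \<le> p + m" using tri[OF pS(1) qS(1) c(1) \<open>p < q\<close> \<open>q < c\<close>] neg qS cn m by linarith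
      then have nm: "n = 2 * m" "c = p + m" using pS m by linarith+
      have "q \<le> a + m"
        using tri[OF a(1) pS(1) qS(1) \<open>a < p\<close> \<open>p < q\<close>] neg pS cn m by linarith
      then have qa: "q = a + m" using qS nm by linarith
      have "S \<subseteq> {a, p, q, c}"
      proof
        fix z assume z: "z \<in> S"
        show "z \<in> {a, p, q, c}"
        proof (rule ccontr)
          assume nz: "z \<notin> {a, p, q, c}"
          then have "a < z" "z < c" using a(2)[OF z] c(2)[OF z] by auto
          from cover[OF z] nz have "z < p \<or> q < z" by auto
          then show False
          proof
            assume "z < p"
            then show False
              using tri[OF z qS(1) c(1)] \<open>p < q\<close> \<open>q < c\<close> \<open>a < z\<close> nm qa cn by linarith
          next
            assume "q < z"
            then show False
              using tri[OF a(1) pS(1) z] \<open>p < q\<close> \<open>a < p\<close> \<open>z < c\<close> nm qa cn by linarith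
          qed
        qed
      qed
      then have "card S \<le> card {a, p, q, c}" by (intro card_mono) auto
      also have "\<dots> \<le> 4" by (simp add: card_insert_if)
      finally show ?thesis using five by simp
    qed
  qed
qed

text \<open>Three vertices of a clique with at least \<open>k\<close> elements extend to a
  \<open>k\<close>-subset and hence lie in one arc, so the bound for triples applies once
  \<open>S\<close> has five elements.\<close>

lemma card_clique_cycle_le:
  assumes n: "3 \<le> n" and k: "3 \<le> k" and S: "kd_clique k d (cycle_graph n) S"
    and L: "Suc (min d (n div 2)) \<le> c * (k - 1)" and c: "1 \<le> c"
  shows "card S \<le> c * (k - 1)"
proof (rule ccontr)
  assume "\<not> ?thesis"
  then have gt: "c * (k - 1) < card S" by simp
  define m where "m = min d (n div 2)"
  have Sn: "S \<subseteq> {..<n}" and arcs: "\<And>T. T \<subseteq> S \<Longrightarrow> card T = k \<Longrightarrow> \<exists>a<n. T \<subseteq> arc n a (Suc m)"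
    using S unfolding kd_clique_cycle_iff[OF n] m_def by blast+
  have fin: "finite S" using Sn finite_subset by blast
  have "k - 1 \<le> c * (k - 1)" using c by simp
  then have kS: "k \<le> card S" using gt by linarith
  \<comment> \<open>For \<open>c = 1\<close> a \<open>k\<close>-subset would have to fit into an arc
    with fewer than \<open>k\<close> vertices.\<close>
  have "c \<noteq> 1"
  proof
    assume "c = 1"
    obtain T where T: "T \<subseteq> S" "card T = k"
      using obtain_subset_with_card_n[OF kS] by blast
    then obtain a where "T \<subseteq> arc n a (Suc m)" using arcs by blast
    then have "card T \<le> Suc m" by (rule order_trans[OF card_mono[OF finite_arc] card_arc_le])
    then show False using T L k \<open>c = 1\<close> by (simp add: m_def)
  qed
  then have "2 * 2 \<le> c * (k - 1)" using c k by (intro mult_le_mono) auto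
  then have five: "5 \<le> card S" using gt by linarith
  have "card S \<le> Suc m"
  proof (rule card_le_if_triples_in_half_arcs[OF Sn _ five])
    show "2 * m \<le> n" by (simp add: m_def)
  next
    fix a b c assume abc: "a \<in> S" "b \<in> S" "c \<in> S" "a < b" "b < c"
    then have "card {a, b, c} \<le> k" using k by simp
    then obtain T where T: "{a, b, c} \<subseteq> T" "T \<subseteq> S" "card T = k"
      using exists_subset_between[of "{a, b, c}" k S] kS fin abc by blast
    then obtain e where e: "e < n" "T \<subseteq> arc n e (Suc m)" using arcs by blast
    have "Suc m \<le> n" using n by (simp add: m_def)
    then have iff: "y \<in> arc n e (Suc m) \<longleftrightarrow> e \<le> y \<and> y < e + Suc m \<or> y + n < e + Suc m"
      if "y \<in> S" for y
      using that Sn e(1) by (intro arc_iff) auto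
    have "a \<in> arc n e (Suc m)" "b \<in> arc n e (Suc m)" "c \<in> arc n e (Suc m)"
      using T e by auto
    then have "e \<le> a \<and> a < e + Suc m \<or> a + n < e + Suc m"
      "e \<le> b \<and> b < e + Suc m \<or> b + n < e + Suc m"
      "e \<le> c \<and> c < e + Suc m \<or> c + n < e + Suc m"
      using iff abc by blast+
    \<comment> \<open>The three alternatives name the gap between cyclically consecutive vertices
      that the arc leaves out.\<close>
    then show "c \<le> a + m \<or> n + a \<le> b + m \<or> n + b \<le> c + m"
      using abc e(1) by linarith
  qed
  then show False using gt L by (simp add: m_def)
qed

section \<open>Colourings of the whole cycle\<close>

text \<open>Double counting: by rotation, each vertex lies in exactly \<open>L\<close> of the
  \<open>n\<close> arcs.\<close>

lemma sum_card_arc: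
  assumes "L \<le> n"
  shows "(\<Sum>a<n. card (S \<inter> arc n a L)) = L * card (S \<inter> {..<n})"
proof -
  have card: "card (S \<inter> arc n a L) = (\<Sum>i<L. of_bool ((i + a) mod n \<in> S))" for a
  proof -
    have "S \<inter> arc n a L = (\<lambda>i. (a + i) mod n) ` {i. i < L \<and> (i + a) mod n \<in> S}"
      by (auto simp: arc_def add.commute)
    moreover have "inj_on (\<lambda>i. (a + i) mod n) {i. i < L \<and> (i + a) mod n \<in> S}"
      using inj_on_add_mod[OF assms, of a] by (rule inj_on_subset) auto
    ultimately have "card (S \<inter> arc n a L) = card {i. i < L \<and> (i + a) mod n \<in> S}"
      by (simp only: card_image)
    then show ?thesis by (simp add: sum_of_bool_eq Int_def)
  qed
  have rot: "(\<Sum>a<n. of_bool ((i + a) mod n \<in> S)) = card (S \<inter> {..<n})" for i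
  proof -
    have "inj_on (\<lambda>a. (i + a) mod n) {..<n}" by (rule inj_on_add_mod) simp
    then have "bij_betw (\<lambda>a. (i + a) mod n) {..<n} {..<n}"
      by (intro bij_betw_imageI endo_inj_surj) auto
    then have "(\<Sum>a<n. of_bool ((i + a) mod n \<in> S)) = (\<Sum>y<n. of_bool (y \<in> S) :: nat)"
      by (rule sum.reindex_bij_betw)
    then show ?thesis by (simp add: sum_of_bool_eq Int_commute)
  qed
  have "(\<Sum>a<n. card (S \<inter> arc n a L)) = (\<Sum>i<L. \<Sum>a<n. of_bool ((i + a) mod n \<in> S))"
    unfolding card by (rule sum.swap)
  then show ?thesis by (simp add: rot)
qed

lemma kd_colorable_cycleD:
  assumes n: "3 \<le> n" and col: "kd_colorable k d (cycle_graph n) c"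
  shows "n \<le> c * ((k - 1) * n div Suc (min d (n div 2)))"
proof -
  let ?L = "Suc (min d (n div 2))"
  have L: "?L \<le> n" using n by linarith
  obtain f where f: "f ` {..<n} \<subseteq> {1..c}"
    and ind: "\<And>i. i \<in> {1..c} \<Longrightarrow> kd_independent k d (cycle_graph n) {v \<in> {..<n}. f v = i}"
    using col by (auto simp: kd_colorable_def)
  have "card {v \<in> {..<n}. f v = i} \<le> (k - 1) * n div ?L" if "i \<in> {1..c}" for i
  proof -
    let ?S = "{v \<in> {..<n}. f v = i}"
    have "card (?S \<inter> arc n a ?L) \<le> k - 1" if "a \<in> {..<n}" for a
    proof -
      have "card (?S \<inter> arc n a ?L) < k"
        using ind[OF \<open>i \<in> {1..c}\<close>] that unfolding kd_independent_cycle_iff[OF n] by blast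
      then show ?thesis by simp
    qed
    then have "(\<Sum>a<n. card (?S \<inter> arc n a ?L)) \<le> (\<Sum>a<n. k - 1)" by (rule sum_mono)
    then have "?L * card (?S \<inter> {..<n}) \<le> n * (k - 1)"
      unfolding sum_card_arc[OF L] by simp
    also have "?S \<inter> {..<n} = ?S" by auto
    finally have "card ?S * ?L \<le> (k - 1) * n" by (simp only: mult.commute)
    then show ?thesis by (simp only: less_eq_div_iff_mult_less_eq zero_less_Suc)
  qed
  then have "(\<Sum>i\<in>{1..c}. card {v \<in> {..<n}. f v = i}) \<le> (\<Sum>i\<in>{1..c}. (k - 1) * n div ?L)"
    by (rule sum_mono)
  moreover have "card (\<Union>i\<in>{1..c}. {v \<in> {..<n}. f v = i}) \<le>
      (\<Sum>i\<in>{1..c}. card {v \<in> {..<n}. f v = i})"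
    by (rule card_UN_le) simp
  moreover have "(\<Union>i\<in>{1..c}. {v \<in> {..<n}. f v = i}) = {..<n}" using f by auto
  ultimately show ?thesis by simp
qed

text \<open>The cycle is cut into \<open>s\<close> blocks of length at most \<open>c\<close>, the block \<open>i\<close>
  starting at \<open>\<lfloor>i n / s\<rfloor>\<close>, and a vertex is coloured by its offset in its block. Equal
  offsets in the blocks \<open>i\<close> and \<open>i + w\<close> are at least \<open>\<lfloor>w n / s\<rfloor> \<ge> L\<close> apart.\<close>

lemma periodic_block_colouring:
  fixes n c s L w :: nat
  assumes n: "0 < n" "n \<le> c * s" and L: "L * s \<le> w * n"
  obtains col :: "nat \<Rightarrow> nat" where "\<And>x. col x < c" "\<And>x. col (x mod n) = col x"
    "\<And>a j. card {i. i < L \<and> col (a + i) = j} \<le> w"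
proof
  have s: "0 < s" using n by (cases s) auto
  define B where "B i = i * n div s" for i
  \<comment> \<open>The largest \<open>i\<close> with \<open>B i \<le> x\<close>, found by solving
    \<open>i * n < Suc x * s\<close> for \<open>i\<close>. Positions are not reduced modulo
    \<open>n\<close>, so that windows may run past \<open>n\<close>.\<close>
  define idx where "idx x = (Suc x * s - 1) div n" for x
  define col where "col x = x - B (idx x)" for x
  have galois: "B i \<le> x \<longleftrightarrow> i \<le> idx x" for i x
  proof -
    have "B i \<le> x \<longleftrightarrow> i * n div s < Suc x" by (simp add: B_def less_Suc_eq_le)
    also have "\<dots> \<longleftrightarrow> i * n < Suc x * s" using s by (rule div_less_iff_less_mult)
    also have "\<dots> \<longleftrightarrow> i * n \<le> Suc x * s - 1"
      using s by (simp add: less_eq_Suc_le[symmetric] Suc_le_eq) linarith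
    also have "\<dots> \<longleftrightarrow> i \<le> idx x"
      unfolding idx_def using n(1) by (simp only: less_eq_div_iff_mult_less_eq)
    finally show ?thesis .
  qed
  have lower: "B (idx x) \<le> x" for x by (simp add: galois)
  then have col_eq: "x = B (idx x) + col x" for x by (simp add: col_def)
  show "col x < c" for x
  proof -
    have "\<not> B (Suc (idx x)) \<le> x" by (simp add: galois)
    \<comment> \<open>The next block starts at most \<open>c\<close> later because
      \<open>n \<le> c * s\<close>.\<close>
    moreover have "B (Suc (idx x)) \<le> (idx x * n + c * s) div s"
      unfolding B_def using n by (intro div_le_mono) simp
    then have "B (Suc (idx x)) \<le> B (idx x) + c" using s by (simp add: B_def)
    ultimately show ?thesis using col_eq[of x] by linarith
  qed
  have period: "col (x + n) = col x" for x
  proof -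
    have "Suc (x + n) * s - 1 = (Suc x * s - 1) + s * n"
      using s by (simp add: algebra_simps)
    then have "idx (x + n) = idx x + s" using n by (simp add: idx_def)
    moreover have "B (i + s) = B i + n" for i
      using s by (simp add: B_def add_mult_distrib)
    ultimately show ?thesis by (simp add: col_def)
  qed
  show "col (x mod n) = col x" for x
  proof -
    have "col (x mod n + m * n) = col (x mod n)" for m
    proof (induction m)
      case (Suc m)
      have "x mod n + Suc m * n = x mod n + m * n + n" by simp
      then show ?case using Suc period by (simp only:)
    qed simp
    from this[of "x div n"] show ?thesis by simp
  qed
  show "card {i. i < L \<and> col (a + i) = j} \<le> w" for a j
  proof (cases "{i. i < L \<and> col (a + i) = j} = {}")
    case False
    let ?I = "{i. i < L \<and> col (a + i) = j}"
    \<comment> \<open>\<open>i0\<close> is the first position of colour \<open>j\<close> in the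
      window. The positions of this colour lie in different blocks, whose indices are among the
      \<open>w\<close> values from that of \<open>i0\<close> on.\<close>
    define i0 where "i0 = Min ?I"
    have "finite ?I" by simp
    then have i0: "i0 \<in> ?I" and i0_le: "i0 \<le> i" if "i \<in> ?I" for i
      using Min_in[OF _ False] Min_le[OF _ that] unfolding i0_def by blast+
    have "inj_on (\<lambda>i. idx (a + i)) ?I"
    proof (rule inj_onI)
      fix i i' assume "i \<in> ?I" "i' \<in> ?I" "idx (a + i) = idx (a + i')"
      then show "i = i'" using col_eq[of "a + i"] col_eq[of "a + i'"] by simp
    qed
    moreover have "idx (a + i) \<in> {idx (a + i0)..<idx (a + i0) + w}" if i: "i \<in> ?I" for i
    proof -
      have "B (idx (a + i0)) \<le> a + i" using lower[of "a + i0"] i0_le[OF i] by linarith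
      then have "idx (a + i0) \<le> idx (a + i)" by (simp add: galois)
      moreover have "idx (a + i) < idx (a + i0) + w"
      proof (rule ccontr)
        assume "\<not> ?thesis"
        then have "(idx (a + i0) * n + L * s) div s \<le> B (idx (a + i))"
          unfolding B_def
          using L mult_le_mono1[of "idx (a + i0) + w" "idx (a + i)" n]
          by (intro div_le_mono) (simp add: add_mult_distrib)
        then have "B (idx (a + i0)) + L \<le> B (idx (a + i))" using s by (simp add: B_def)
        moreover have "a + i = B (idx (a + i)) + j" "a + i0 = B (idx (a + i0)) + j" "i < L"
          using i i0[OF i] col_eq[of "a + i"] col_eq[of "a + i0"] by auto
        ultimately show False by linarith
      qed
      ultimately show ?thesis by simp
    qed
    ultimately have "card ?I \<le> card {idx (a + i0)..<idx (a + i0) + w}"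
      by (intro card_inj_on_le[where f = "\<lambda>i. idx (a + i)"]) auto
    then show ?thesis by simp
  qed (simp only: card.empty)
qed

text \<open>The quotient in the hypothesis is the largest number of blocks that keeps equal offsets
  far enough apart; the hypothesis itself keeps the blocks at length at most
  \<open>c\<close>.\<close>

lemma kd_colorable_cycleI:
  assumes n: "3 \<le> n" and k: "0 < k" and c: "n \<le> c * ((k - 1) * n div Suc (min d (n div 2)))"
  shows "kd_colorable k d (cycle_graph n) c"
proof -
  let ?L = "Suc (min d (n div 2))"
  have "?L * ((k - 1) * n div ?L) \<le> (k - 1) * n" by (rule times_div_less_eq_dividend)
  with n c obtain col where col: "\<And>x. col x < c" "\<And>x. col (x mod n) = col x"
    and classes: "\<And>a j. card {i. i < ?L \<and> col (a + i) = j} \<le> k - 1"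
    by (rule_tac periodic_block_colouring[of n c "(k - 1) * n div ?L" ?L "k - 1"]) auto
  have "card ({v \<in> {..<n}. Suc (col v) = j} \<inter> arc n a ?L) < k" for j a
  proof -
    have "{v \<in> {..<n}. Suc (col v) = j} \<inter> arc n a ?L \<subseteq>
        (\<lambda>i. (a + i) mod n) ` {i. i < ?L \<and> col (a + i) = j - 1}"
      by (auto simp: arc_def col(2))
    then have "card ({v \<in> {..<n}. Suc (col v) = j} \<inter> arc n a ?L) \<le>
        card {i. i < ?L \<and> col (a + i) = j - 1}"
      by (rule surj_card_le[rotated]) simp
    also have "\<dots> \<le> k - 1" by (rule classes)
    finally show ?thesis using k by linarith
  qed
  then have "kd_independent k d (cycle_graph n) {v \<in> {..<n}. Suc (col v) = j}" for j
    unfolding kd_independent_cycle_iff[OF n] by blast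
  then show ?thesis
    unfolding kd_colorable_def verts_cycle_graph
    using col(1) by (intro exI[of _ "\<lambda>v. Suc (col v)"]) (auto simp: Suc_le_eq)
qed

text \<open>Only the cycle itself can violate the equation. There the clique side equals
  \<open>c\<close>, so perfection means that \<open>c\<close> colours suffice.\<close>

lemma kd_perfect_cycle_iff:
  fixes k d n :: nat
  assumes n: "3 \<le> n" and k: "3 \<le> k"
  defines "L \<equiv> Suc (min d (n div 2))"
  defines "c \<equiv> (L + (k - 1) - 1) div (k - 1)"
  shows "kd_perfect k d (cycle_graph n) \<longleftrightarrow> n \<le> c * ((k - 1) * n div L)"
proof -
  let ?G = "cycle_graph n"
  have c: "1 \<le> c" "L \<le> c * (k - 1)" "(c - 1) * (k - 1) < L"
    using ceil_div_bounds[of "k - 1" L] k by (simp_all add: L_def c_def)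
  have whole: "H = ?G" if "induced_subgraph H ?G" "verts H = {..<n}" for H
  proof -
    have "e \<subseteq> {..<n}" if "e \<in> edges ?G" for e
      using simple_graph_cycle_graph[OF n] that by (auto simp: simple_graph_def)
    then have "edges H = edges ?G" using that by (auto simp: induced_subgraph_def)
    then show ?thesis using that by simp
  qed
  have "kd_perfect k d ?G \<longleftrightarrow>
      kd_chromatic_number k d ?G = ceiling_div (kd_clique_number k d ?G) (k - 1)"
  proof
    assume "kd_perfect k d ?G"
    then show "kd_chromatic_number k d ?G = ceiling_div (kd_clique_number k d ?G) (k - 1)"
      unfolding kd_perfect_def using induced_cycle_refl[OF n] by blast
  next
    assume "kd_chromatic_number k d ?G = ceiling_div (kd_clique_number k d ?G) (k - 1)"
    then show "kd_perfect k d ?G"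
      unfolding kd_perfect_def
      using whole kd_chromatic_number_proper_induced[of _ n k d] k
      by (metis One_nat_def Suc_1 Suc_leD eval_nat_numeral(3))
  qed
  \<comment> \<open>Only the rounded quotient is computed: for \<open>n = 4\<close>,
    \<open>k = 3\<close>, \<open>d = 2\<close> all four vertices form a clique although
    \<open>L = 3\<close>.\<close>
  also have "ceiling_div (kd_clique_number k d ?G) (k - 1) = enat c"
  proof (rule antisym)
    show "ceiling_div (kd_clique_number k d ?G) (k - 1) \<le> enat c"
      using card_clique_cycle_le[OF n k, of d _ c] c k
      by (simp add: ceiling_div_le_iff kd_clique_number_le_iff L_def)
    have "card (arc n 0 L) = L" using n by (intro card_arc) (simp add: L_def)
    then show "enat c \<le> ceiling_div (kd_clique_number k d ?G) (k - 1)"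
      using kd_clique_arc[OF n, of k d] c k
      by (intro le_ceiling_div_clique_number[of k d ?G "arc n 0 L"]) (simp_all add: L_def)
  qed
  also have "kd_chromatic_number k d ?G = enat c \<longleftrightarrow> kd_chromatic_number k d ?G \<le> enat c"
    using ceiling_div_clique_number_le[of k d ?G] k calculation
      \<open>ceiling_div (kd_clique_number k d ?G) (k - 1) = enat c\<close> by auto
  also have "\<dots> \<longleftrightarrow> kd_colorable k d ?G c"
    using k c by (simp add: kd_chromatic_number_le_iff)
  also have "\<dots> \<longleftrightarrow> n \<le> c * ((k - 1) * n div L)"
    using kd_colorable_cycleD[OF n] kd_colorable_cycleI[OF n] k unfolding L_def by auto
  finally show ?thesis .
qed

section \<open>Arithmetic of the criterion\<close>

lemma ceiling_of_nat_div:
  fixes m w :: nat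
  assumes "0 < w" "0 < m"
  shows "\<lceil>real m / real w\<rceil> = int ((m + w - 1) div w)"
proof -
  define c where "c = (m + w - 1) div w"
  have c: "1 \<le> c" "m \<le> c * w" "(c - 1) * w < m"
    using ceil_div_bounds[OF assms] by (simp_all add: c_def)
  have "real m \<le> real (c * w)" "real ((c - 1) * w) < real m"
    using c by (simp_all only: of_nat_le_iff of_nat_less_iff)
  then have "real m \<le> real c * real w" "(real c - 1) * real w < real m"
    using c(1) by (simp_all add: of_nat_diff)
  then show ?thesis
    using assms unfolding c_def[symmetric]
    by (intro ceiling_unique) (simp_all add: field_simps)
qed

text \<open>The quotient \<open>w * n / L\<close> is \<open>2 * w - w / L\<close> for odd
  \<open>n\<close> and \<open>2 * w - 2 * w / L\<close> for even \<open>n\<close>. It rounds down to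
  \<open>2 * w - 1\<close> unless \<open>n\<close> is even and \<open>L < 2 * w\<close>.\<close>

lemma block_bound_half:
  fixes n w c :: nat
  assumes w: "2 \<le> w" "w < L" and L: "L = Suc (n div 2)" and c: "c = (L + w - 1) div w"
  shows "n \<le> c * (w * n div L) \<longleftrightarrow> n \<le> (2 * w - 1) * c"
proof -
  obtain v where v: "w = Suc v" using w by (cases w) auto
  define m where "m = n div 2"
  have Lm: "L = Suc m" using L by (simp add: m_def)
  have full: ?thesis if "w * n div L = 2 * w - 1"
    using that by (simp add: mult.commute)
  show ?thesis
  proof (cases "even n")
    case False
    then have n: "n = 2 * m + 1" by (simp add: m_def)
    have "w * n div L = 2 * v + 1"
      by (rule div_nat_eqI) (use w v Lm n in \<open>simp_all add: algebra_simps\<close>)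
    then show ?thesis using full v by simp
  next
    case True
    then have n: "n = 2 * m" by (simp add: m_def)
    show ?thesis
    proof (cases "2 * w \<le> L")
      case True
      have "w * n div L = 2 * v + 1"
        by (rule div_nat_eqI) (use True v Lm n in \<open>simp_all add: algebra_simps\<close>)
      then show ?thesis using full v by simp
    next
      case False
      \<comment> \<open>Here the quotient drops to \<open>2 * w - 2\<close>, but
        \<open>c = 2\<close> and both inequalities hold, since \<open>n = 2 * L - 2\<close>.\<close>
      have "w * n div L = 2 * v"
        by (rule div_nat_eqI) (use False w v Lm n in \<open>simp_all add: algebra_simps\<close>)
      moreover have "c = 2"
        unfolding c by (rule div_nat_eqI) (use False w in simp_all)
      ultimately show ?thesis using False v Lm n by simp
    qed
  qed
qed

text \<open>The factor \<open>w\<close> cancels, and \<open>n \<le> c * (n div c)\<close> leaves no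
  room for a remainder.\<close>

lemma block_bound_integral:
  fixes n w L c :: nat
  assumes "0 < w" "0 < L" and L: "L = c * w"
  shows "n \<le> ((L + w - 1) div w) * (w * n div L) \<longleftrightarrow> c dvd n"
proof -
  have "(L + w - 1) div w = c"
    by (rule div_nat_eqI) (use assms in \<open>simp_all add: mult.commute\<close>)
  moreover have "w * n div L = n div c"
    unfolding L using assms by (simp add: mult.commute)
  moreover have "n \<le> c * (n div c) \<longleftrightarrow> c * (n div c) = n"
    using times_div_less_eq_dividend[of c n] by linarith
  ultimately show ?thesis by (simp add: dvd_mult_div_cancel) (metis dvd_def dvd_mult_div_cancel)
qed

text \<open>With \<open>s = \<lfloor>n / q\<rfloor>\<close>, the condition
  \<open>n < (j + 1) * q\<close> means \<open>s \<le> j\<close>. If the bound fails,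
  \<open>j = s\<close> is a witness; if it holds, \<open>j * \<lceil>q\<rceil>\<close> is at least
  \<open>n\<close> for all such \<open>j\<close>.\<close>

lemma block_bound_nonintegral:
  fixes n w L :: nat
  assumes w: "0 < w" and L: "0 < L" "L \<le> n"
  defines "q \<equiv> real L / real w"
  assumes q: "q \<notin> \<int>"
  shows "n \<le> ((L + w - 1) div w) * (w * n div L) \<longleftrightarrow>
    \<not> (\<exists>j::int. 1 \<le> j \<and> real_of_int j < (q - 1) / (real_of_int \<lceil>q\<rceil> - q) \<and>
      j * \<lceil>q\<rceil> < int n \<and> real n < (real_of_int j + 1) * q)"
proof -
  define c s where "c = (L + w - 1) div w" and "s = w * n div L"
  have c: "\<lceil>q\<rceil> = int c" using ceiling_of_nat_div[OF w L(1)] by (simp add: q_def c_def)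
  have cq: "q < real c"
    using q le_of_int_ceiling[of q] c by (metis Ints_of_int of_int_of_nat_eq order_le_less)
  \<comment> \<open>Multiplied by \<open>w\<close>, the condition becomes one on integers.\<close>
  have lt_iff: "real n < (real_of_int j + 1) * q \<longleftrightarrow> int (w * n) < (j + 1) * int L" for j
  proof -
    have "real n < (real_of_int j + 1) * q \<longleftrightarrow>
        real_of_int (int (w * n)) < real_of_int ((j + 1) * int L)"
      using w by (simp add: q_def field_simps)
    then show ?thesis by (simp only: of_int_less_iff)
  qed
  show ?thesis
  proof (cases "n \<le> c * s")
    case True
    have False if j: "j * int c < int n" "int (w * n) < (j + 1) * int L" for j
    proof -
      have "s * L \<le> w * n" unfolding s_def by (rule div_times_less_eq_dividend)
      then have "int s * int L \<le> int (w * n)" by (simp only: of_nat_le_iff flip: of_nat_mult)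
      also note j(2)
      finally have "int s < j + 1" using L by simp
      then have "int s * int c \<le> j * int c" by (intro mult_right_mono) auto
      moreover have "int n \<le> int (c * s)" using True by (simp only: of_nat_le_iff)
      ultimately show False using j(1) by (simp add: mult.commute)
    qed
    then show ?thesis using True lt_iff unfolding c c_def[symmetric] s_def[symmetric] by blast
  next
    case False
    have "L \<le> w * n" using L w by (metis le_trans mult_le_mono1 mult_1 Suc_leI One_nat_def)
    then have s1: "1 \<le> int s" using L by (simp add: s_def Suc_le_eq div_greater_zero_iff)
    have "w * n < Suc s * L"
      unfolding s_def using L by (metis dividend_less_div_times mult.commute mult_Suc_right add.commute)
    then have "int (w * n) < int (Suc s * L)" by (simp only: of_nat_less_iff)
    then have up: "real n < (real_of_int (int s) + 1) * q"
      unfolding lt_iff by (simp add: algebra_simps)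
    have lo: "int s * \<lceil>q\<rceil> < int n"
      using False unfolding c by (simp add: mult.commute flip: of_nat_mult)
    \<comment> \<open>Integrality turns \<open>s * c < n\<close> into
      \<open>s * c + 1 \<le> n\<close>; with \<open>n < (s + 1) * q\<close> this rearranges to the
      bound on \<open>j\<close>.\<close>
    have "real (s * c) + 1 \<le> real n"
      using False by (simp add: mult.commute flip: of_nat_mult of_nat_Suc)
    then have "real s * (real c - q) < q - 1" using up by (simp add: algebra_simps)
    then have "real_of_int (int s) < (q - 1) / (real_of_int \<lceil>q\<rceil> - q)"
      using cq unfolding c by (simp add: pos_less_divide_eq)
    then show ?thesis
      using False s1 up lo unfolding c_def[symmetric] s_def[symmetric] by blast
  qed
qed

theorem theorem5p13:
  fixes k d n :: nat
  assumes "3 \<le> k" and "k \<le> d + 1" and "3 \<le> n"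
  shows
    "(diam (cycle_graph n) < enat d \<longrightarrow>
        (diam (cycle_graph n) \<le> enat (k - 2) \<longrightarrow> kd_perfect k d (cycle_graph n)) \<and>
        (diam (cycle_graph n) > enat (k - 2) \<longrightarrow>
           (kd_perfect k d (cycle_graph n) \<longleftrightarrow>
              int n \<le> (2 * int k - 3) *
                \<lceil>(real_of_int \<lfloor>real n / 2\<rfloor> + 1) / (real k - 1)\<rceil>))) \<and>
     (enat d \<le> diam (cycle_graph n) \<longrightarrow>
        (let q = (real d + 1) / (real k - 1) in
          (q \<in> \<int> \<longrightarrow> (kd_perfect k d (cycle_graph n) \<longleftrightarrow> \<lfloor>q\<rfloor> dvd int n)) \<and>
          (q \<notin> \<int> \<longrightarrow>
             (kd_perfect k d (cycle_graph n) \<longleftrightarrow>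
                \<not> (\<exists>j::int. 1 \<le> j \<and>
                       real_of_int j < (q - 1) / (real_of_int \<lceil>q\<rceil> - q) \<and>
                       j * \<lceil>q\<rceil> < int n \<and>
                       real n < (real_of_int j + 1) * q)))))"
proof -
  \<comment> \<open>\<open>L\<close> is \<open>d + 1\<close> if \<open>d\<close> is at most the
    diameter, and \<open>n div 2 + 1\<close> otherwise. In the first case
    \<open>q = L / w\<close>.\<close>
  define L w where "L = Suc (min d (n div 2))" and "w = k - 1"
  have w: "2 \<le> w" "k = Suc w" using assms by (auto simp: w_def)
  have Ln: "0 < L" "L \<le> n" using assms by (auto simp: L_def)
  have perfect: "kd_perfect k d (cycle_graph n) \<longleftrightarrow>
      n \<le> ((L + w - 1) div w) * (w * n div L)"
    unfolding L_def w_def by (rule kd_perfect_cycle_iff) (use assms in auto)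
  have rk: "real k - 1 = real w" using w by simp
  show ?thesis
    unfolding diam_cycle_graph[OF assms(3)] Let_def rk enat_ord_simps
  proof (intro conjI impI)
    assume "n div 2 < d" "n div 2 \<le> k - 2"
    then have L: "L = Suc (n div 2)" "L \<le> w" using w by (auto simp: L_def)
    \<comment> \<open>Since \<open>L \<le> w\<close>, a single colour suffices.\<close>
    have "(L + w - 1) div w = 1" by (rule div_nat_eqI) (use L w in simp_all)
    moreover have "n \<le> w * n div L"
      using Ln(1) mult_le_mono1[OF L(2), of n]
      by (simp only: less_eq_div_iff_mult_less_eq mult.commute[of n])
    ultimately show "kd_perfect k d (cycle_graph n)" by (simp add: perfect)
  next
    assume *: "n div 2 < d" "k - 2 < n div 2"
    then have L: "L = Suc (n div 2)" "w < L" using w by (auto simp: L_def)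
    let ?c = "(L + w - 1) div w"
    have "real_of_int \<lfloor>real n / 2\<rfloor> + 1 = real L"
      using floor_divide_of_nat_eq[where 'a = real, of n 2] L by simp
    then have "\<lceil>(real_of_int \<lfloor>real n / 2\<rfloor> + 1) / real w\<rceil> = int ?c"
      using ceiling_of_nat_div[of w L] w Ln by simp
    moreover have "2 * int k - 3 = int (2 * w - 1)" using w by simp
    moreover have "n \<le> ?c * (w * n div L) \<longleftrightarrow> n \<le> (2 * w - 1) * ?c"
      by (rule block_bound_half) (use w L in auto)
    ultimately show "kd_perfect k d (cycle_graph n) \<longleftrightarrow> int n \<le> (2 * int k - 3) *
        \<lceil>(real_of_int \<lfloor>real n / 2\<rfloor> + 1) / real w\<rceil>"
      unfolding perfect by (simp only: of_nat_le_iff flip: of_nat_mult)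
  next
    assume "d \<le> n div 2" and "(real d + 1) / real w \<in> \<int>"
    then have rL: "real d + 1 = real L" and "real L / real w \<in> \<int>" by (auto simp: L_def add.commute)
    then obtain z where z: "real L / real w = of_int z" by (auto elim: Ints_cases)
    \<comment> \<open>The integer \<open>q\<close> is positive, hence a natural number
      \<open>c\<close> with \<open>L = c * w\<close>.\<close>
    then have "0 < real_of_int z" using w Ln by (metis divide_pos_pos of_nat_0_less_iff
          zero_less_numeral order_less_le_trans)
    then have "0 \<le> z" by simp
    then obtain c where c: "z = int c" using nonneg_int_cases by blast
    then have "real L = real (c * w)" using z w by (simp add: field_simps)
    then have "L = c * w" by (simp only: of_nat_eq_iff)
    then have "n \<le> ((L + w - 1) div w) * (w * n div L) \<longleftrightarrow> c dvd n"
      by (intro block_bound_integral) (use w Ln in auto)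
    then show "kd_perfect k d (cycle_graph n) \<longleftrightarrow> \<lfloor>(real d + 1) / real w\<rfloor> dvd int n"
      by (simp add: perfect rL z c)
  next
    assume "d \<le> n div 2" and q: "(real d + 1) / real w \<notin> \<int>"
    then have rL: "real d + 1 = real L" by (auto simp: L_def)
    show "kd_perfect k d (cycle_graph n) \<longleftrightarrow>
        \<not> (\<exists>j::int. 1 \<le> j \<and>
          real_of_int j < ((real d + 1) / real w - 1) /
            (real_of_int \<lceil>(real d + 1) / real w\<rceil> - (real d + 1) / real w) \<and>
          j * \<lceil>(real d + 1) / real w\<rceil> < int n \<and>
          real n < (real_of_int j + 1) * ((real d + 1) / real w))"
      unfolding perfect rL
      by (rule block_bound_nonintegral) (use w Ln q rL in auto)
  qed
qed

end
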